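(* For every Boolean function $f\in\mathcal B_n$ with $f(N)=1$ we have $\mu(f)\le 1+CoS(f)$.
   Context: Let $N=\{1,\dots,n\}$ and let $\mathcal B_n$ be the set of all functions $f:2^N\to\{0,1\}$ with $f(\emptyset)=0$. For real weights write $w(S)=\sum_{i\in S}w_i$. For real $\alpha\ge 1$, $f$ is $\alpha$-roughly weighted if there are $w_1,\dots,w_n\in\mathbb R$ with $w(S)\ge 1$ for all $S\subseteq N$ with $f(S)=1$ and $w(S)\le\alpha$ for all $S\subseteq N$ with $f(S)=0$. The critical threshold value $\mu(f)$ is the smallest $\alpha\ge 1$ such that $f$ is $\alpha$-roughly weighted. The cost of stability $CoS(f)$ is the optimal value of the linear program: minimize $\Delta$ subject to $\Delta\ge 0$, $\sum_{i\in N}p_i=f(N)+\Delta$, $\sum_{i\in S}p_i\ge f(S)$ for all $S\subseteq N$, and $p_i\ge 0$ for all $i\in N$. *)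

theory Defs
  imports Complex_Main "HOL-Library.FuncSet"
begin

definition boolean_functions :: "nat \<Rightarrow> (nat set \<Rightarrow> nat) set" where
  "boolean_functions n = {f \<in> Pow {1..n} \<rightarrow>\<^sub>E {0, 1}. f {} = 0}"

definition weight :: "(nat \<Rightarrow> real) \<Rightarrow> nat set \<Rightarrow> real" where
  "weight w S = (\<Sum>i\<in>S. w i)"

(* Weights are functions on all of nat; only their values on {1..n} matter here and below. *)
definition roughly_weighted :: "nat \<Rightarrow> real \<Rightarrow> (nat set \<Rightarrow> nat) \<Rightarrow> bool" where
  "roughly_weighted n \<alpha> f \<longleftrightarrow>
     (\<exists>w :: nat \<Rightarrow> real.
        (\<forall>S. S \<subseteq> {1..n} \<longrightarrow> f S = 1 \<longrightarrow> weight w S \<ge> 1) \<and>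
        (\<forall>S. S \<subseteq> {1..n} \<longrightarrow> f S = 0 \<longrightarrow> weight w S \<le> \<alpha>))"

(* LEAST on real denotes a genuine minimum, not an infimum: it is unspecified
   when no minimum exists. *)
definition critical_threshold :: "nat \<Rightarrow> (nat set \<Rightarrow> nat) \<Rightarrow> real" where
  "critical_threshold n f = (LEAST \<alpha>. \<alpha> \<ge> 1 \<and> roughly_weighted n \<alpha> f)"

definition cos_feasible :: "nat \<Rightarrow> (nat set \<Rightarrow> nat) \<Rightarrow> real \<Rightarrow> (nat \<Rightarrow> real) \<Rightarrow> bool" where
  "cos_feasible n f \<Delta> p \<longleftrightarrow>
     \<Delta> \<ge> 0 \<and>
     (\<Sum>i\<in>{1..n}. p i) = real (f {1..n}) + \<Delta> \<and>
     (\<forall>S. S \<subseteq> {1..n} \<longrightarrow> (\<Sum>i\<in>S. p i) \<ge> real (f S)) \<and>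
     (\<forall>i\<in>{1..n}. p i \<ge> 0)"

definition cost_of_stability :: "nat \<Rightarrow> (nat set \<Rightarrow> nat) \<Rightarrow> real" where
  "cost_of_stability n f = (LEAST \<Delta>. \<exists>p. cos_feasible n f \<Delta> p)"

end

theory Submission
  imports Defs "HOL-Analysis.Elementary_Metric_Spaces"
begin

text \<open>
  An optimal \<open>p\<close> of the stability program has nonnegative entries and total weight \<open>1 + \<Delta>\<close>,
  so every coalition has weight at most \<open>1 + \<Delta>\<close> and \<open>p\<close> itself is a rough weighting with
  threshold \<open>1 + \<Delta>\<close>. The substance is that both minima are attained. The set of feasible
  objective values is a projection of a polyhedron; weights in a rough weighting may be unbounded, so
  compactness is not available, but Fourier-Motzkin elimination shows that the projection is closed.
\<close>

text \<open>Supplies a value for the eliminated variable. \<open>Max L\<close> works unless there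
  are no lower bounds; then \<open>Min U\<close> does, or anything at all if \<open>U\<close> is
  empty too.\<close>

lemma between_finite_sets:
  fixes L U :: "'a::linorder set"
  assumes "finite L" "finite U" "\<And>l u. l \<in> L \<Longrightarrow> u \<in> U \<Longrightarrow> l \<le> u"
  shows "\<exists>z. (\<forall>l\<in>L. l \<le> z) \<and> (\<forall>u\<in>U. z \<le> u)"
proof (cases "L = {}")
  case True
  show ?thesis
  proof (cases "U = {}")
    case True
    with \<open>L = {}\<close> show ?thesis by simp
  next
    case False
    with \<open>L = {}\<close> assms show ?thesis by (intro exI[of _ "Min U"]) auto
  qed
next
  case False
  with assms show ?thesis by (intro exI[of _ "Max L"]) auto
qed

text \<open>A constraint is a pair of a coefficient vector and a right-hand side depending
  continuously on the parameter \<open>x\<close>. Eliminating one variable yields another finite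
  system of this kind, so induction on the variables, with \<open>C\<close> arbitrary, ends at a
  finite intersection of closed sets \<open>0 \<le> snd c x\<close>.\<close>

lemma closed_projection_linear_system:
  fixes C :: "(('i \<Rightarrow> real) \<times> ('x::topological_space \<Rightarrow> real)) set"
  assumes "finite I" "finite C" "\<And>c. c \<in> C \<Longrightarrow> continuous_on UNIV (snd c)"
  shows "closed {x. \<exists>w. \<forall>c\<in>C. (\<Sum>i\<in>I. fst c i * w i) \<le> snd c x}"
  using assms
proof (induction I arbitrary: C rule: finite_induct)
  case empty
  have "{x. \<exists>w::'i \<Rightarrow> real. \<forall>c\<in>C. (\<Sum>i\<in>{}. fst c i * w i) \<le> snd c x} = (\<Inter>c\<in>C. {x. 0 \<le> snd c x})"
    by auto
  then show ?case
    using empty by (auto intro!: closed_INT closed_Collect_le continuous_intros)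
next
  case (insert j I)
  \<comment> \<open>For the variable \<open>j\<close>, constraints in \<open>P\<close> give upper
    bounds, those in \<open>M\<close> lower bounds, and those in \<open>Z\<close> do not involve
    it.\<close>
  define P where "P = {c \<in> C. fst c j > 0}"
  define M where "M = {c \<in> C. fst c j < 0}"
  define Z where "Z = {c \<in> C. fst c j = 0}"
  \<comment> \<open>For \<open>c\<close> in \<open>P\<close> and \<open>d\<close> in
    \<open>M\<close> the multipliers \<open>1 / fst c j\<close> and \<open>- 1 / fst d j\<close> are
    positive, so this is a valid combination of the two inequalities, and the coefficient of
    \<open>j\<close> cancels.\<close>
  define comb :: "('i \<Rightarrow> real) \<times> ('x \<Rightarrow> real) \<Rightarrow> ('i \<Rightarrow> real) \<times> ('x \<Rightarrow> real) \<Rightarrow> ('i \<Rightarrow> real) \<times> ('x \<Rightarrow> real)"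
    where "comb c d = ((\<lambda>i. fst c i / fst c j - fst d i / fst d j),
                       (\<lambda>x. snd c x / fst c j - snd d x / fst d j))" for c d
  define C' where "C' = Z \<union> (\<Union>c\<in>P. comb c ` M)"
  have "finite C'"
    using insert.prems(1) by (simp add: C'_def P_def M_def Z_def)
  moreover have "continuous_on UNIV (snd c)" if "c \<in> C'" for c
  proof (cases "c \<in> Z")
    case True
    then show ?thesis using insert.prems(2) by (simp add: Z_def)
  next
    case False
    with that obtain d e where de: "d \<in> P" "e \<in> M" "c = comb d e"
      unfolding C'_def by blast
    then have "continuous_on UNIV (snd d)" "continuous_on UNIV (snd e)"
      using insert.prems(2) by (simp_all add: P_def M_def)
    with de show ?thesis
      by (auto simp: comb_def P_def M_def intro!: continuous_intros)
  qed
  ultimately have closed': "closed {x. \<exists>w. \<forall>c\<in>C'. (\<Sum>i\<in>I. fst c i * w i) \<le> snd c x}"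
    by (rule insert.IH)
  have elim: "(\<exists>z. \<forall>c\<in>C. fst c j * z + (\<Sum>i\<in>I. fst c i * w i) \<le> snd c x) \<longleftrightarrow>
      (\<forall>c\<in>C'. (\<Sum>i\<in>I. fst c i * w i) \<le> snd c x)" for w x
  proof -
    define B where "B c = (snd c x - (\<Sum>i\<in>I. fst c i * w i)) / fst c j" for c
    have pos: "fst c j * z + (\<Sum>i\<in>I. fst c i * w i) \<le> snd c x \<longleftrightarrow> z \<le> B c" if "c \<in> P" for c z
      using that by (auto simp: P_def B_def field_simps)
    have neg: "fst c j * z + (\<Sum>i\<in>I. fst c i * w i) \<le> snd c x \<longleftrightarrow> B c \<le> z" if "c \<in> M" for c z
      using that by (auto simp: M_def B_def field_simps)
    have C_split: "C = Z \<union> P \<union> M"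
      by (auto simp: P_def M_def Z_def)
    have comb: "(\<Sum>i\<in>I. fst (comb c d) i * w i) \<le> snd (comb c d) x \<longleftrightarrow> B d \<le> B c" for c d
    proof -
      have "(\<Sum>i\<in>I. fst (comb c d) i * w i) =
          (\<Sum>i\<in>I. fst c i * w i) / fst c j - (\<Sum>i\<in>I. fst d i * w i) / fst d j"
        by (simp add: comb_def left_diff_distrib sum_subtractf sum_divide_distrib)
      moreover have "snd (comb c d) x = snd c x / fst c j - snd d x / fst d j"
        by (simp add: comb_def)
      ultimately show ?thesis
        unfolding B_def diff_divide_distrib by linarith
    qed
    have "(\<exists>z. \<forall>c\<in>C. fst c j * z + (\<Sum>i\<in>I. fst c i * w i) \<le> snd c x) \<longleftrightarrow>
        (\<forall>c\<in>Z. (\<Sum>i\<in>I. fst c i * w i) \<le> snd c x) \<and> (\<exists>z. (\<forall>d\<in>M. B d \<le> z) \<and> (\<forall>c\<in>P. z \<le> B c))"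
      unfolding C_split ball_Un using pos neg by (auto simp: Z_def)
    \<comment> \<open>A suitable \<open>z\<close> exists iff no lower bound exceeds an upper bound;
      finiteness of both families is what makes this sufficient.\<close>
    also have "(\<exists>z. (\<forall>d\<in>M. B d \<le> z) \<and> (\<forall>c\<in>P. z \<le> B c)) \<longleftrightarrow> (\<forall>c\<in>P. \<forall>d\<in>M. B d \<le> B c)"
    proof
      assume "\<forall>c\<in>P. \<forall>d\<in>M. B d \<le> B c"
      moreover have "finite (B ` M)" "finite (B ` P)"
        using insert.prems by (auto simp: M_def P_def)
      ultimately show "\<exists>z. (\<forall>d\<in>M. B d \<le> z) \<and> (\<forall>c\<in>P. z \<le> B c)"
        using between_finite_sets[of "B ` M" "B ` P"] by auto
    qed (auto intro: order_trans)
    also have "(\<forall>c\<in>P. \<forall>d\<in>M. B d \<le> B c) \<longleftrightarrow>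
        (\<forall>c\<in>(\<Union>c\<in>P. comb c ` M). (\<Sum>i\<in>I. fst c i * w i) \<le> snd c x)"
      by (simp add: comb)
    finally show ?thesis
      by (simp only: C'_def ball_Un)
  qed
  \<comment> \<open>As \<open>j\<close> is not in \<open>I\<close>, resetting \<open>w\<close> at
    \<open>j\<close> leaves the rest of the sum alone, so \<open>z\<close> can be chosen
    independently of \<open>w\<close>.\<close>
  have split_sum: "(\<Sum>i\<in>insert j I. a i * (w(j := z)) i) = a j * z + (\<Sum>i\<in>I. a i * w i)" for a w z
  proof -
    have "(\<Sum>i\<in>I. a i * (w(j := z)) i) = (\<Sum>i\<in>I. a i * w i)"
      using insert.hyps by (intro sum.cong) auto
    then show ?thesis using insert.hyps by simp
  qed
  have "(\<exists>w. \<forall>c\<in>C. (\<Sum>i\<in>insert j I. fst c i * w i) \<le> snd c x) \<longleftrightarrow>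
      (\<exists>w z. \<forall>c\<in>C. fst c j * z + (\<Sum>i\<in>I. fst c i * w i) \<le> snd c x)" (is "?L \<longleftrightarrow> ?R") for x
  proof
    assume ?L
    then show ?R using insert.hyps by auto
  next
    assume ?R
    then obtain w z where "\<forall>c\<in>C. fst c j * z + (\<Sum>i\<in>I. fst c i * w i) \<le> snd c x"
      by blast
    then have "\<forall>c\<in>C. (\<Sum>i\<in>insert j I. fst c i * (w(j := z)) i) \<le> snd c x"
      by (simp only: split_sum)
    then show ?L by blast
  qed
  with closed' show ?case
    by (simp only: elim)
qed

text \<open>\<open>LEAST\<close> on the reals is meaningful only for an attained minimum; a nonempty
  closed set bounded below contains its infimum.\<close>

lemma closed_Least:
  fixes A :: "real set"
  assumes "closed A" "A \<noteq> {}" "bdd_below A"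
  shows "(LEAST a. a \<in> A) \<in> A" and "a \<in> A \<Longrightarrow> (LEAST a. a \<in> A) \<le> a"
proof -
  have "(LEAST a. a \<in> A) = Inf A"
    using assms by (intro Least_equality closed_contains_Inf cInf_lower)
  then show "(LEAST a. a \<in> A) \<in> A" "a \<in> A \<Longrightarrow> (LEAST a. a \<in> A) \<le> a"
    using assms by (simp_all add: closed_contains_Inf cInf_lower)
qed

text \<open>Brings coalition sums into the shape of a linear form over one fixed index set, as
  elimination requires; \<open>b\<close> will be the sign of the inequality.\<close>

lemma sum_subset_indicator:
  fixes w :: "'a \<Rightarrow> real"
  assumes "finite N" "S \<subseteq> N"
  shows "(\<Sum>i\<in>N. (if i \<in> S then b else 0) * w i) = b * (\<Sum>i\<in>S. w i)"
proof -
  have "(\<Sum>i\<in>N. (if i \<in> S then b else 0) * w i) = (\<Sum>i\<in>N. if i \<in> S then b * w i else 0)"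
    by (rule sum.cong) auto
  also have "\<dots> = (\<Sum>i\<in>S. b * w i)"
    using assms by (simp add: sum.inter_restrict[symmetric] Int_absorb1)
  finally show ?thesis by (simp add: sum_distrib_left)
qed

lemma closed_roughly_weighted: "closed {\<alpha>. \<alpha> \<ge> 1 \<and> roughly_weighted n \<alpha> f}"
proof -
  \<comment> \<open>Lower bounds on coalition weights are negated to become upper bounds. The
    parameter is \<alpha> itself.\<close>
  define C :: "((nat \<Rightarrow> real) \<times> (real \<Rightarrow> real)) set" where
    "C = (\<lambda>S. (\<lambda>i. if i \<in> S then - 1 else 0, \<lambda>\<alpha>. - 1)) ` {S. S \<subseteq> {1..n} \<and> f S = 1} \<union>
         (\<lambda>S. (\<lambda>i. if i \<in> S then 1 else 0, \<lambda>\<alpha>. \<alpha>)) ` {S. S \<subseteq> {1..n} \<and> f S = 0}"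
  have "closed {\<alpha>. \<exists>w. \<forall>c\<in>C. (\<Sum>i\<in>{1..n}. fst c i * w i) \<le> snd c \<alpha>}"
    by (rule closed_projection_linear_system)
      (auto simp: C_def intro!: continuous_intros)
  also have "{\<alpha>. \<exists>w. \<forall>c\<in>C. (\<Sum>i\<in>{1..n}. fst c i * w i) \<le> snd c \<alpha>} = {\<alpha>. roughly_weighted n \<alpha> f}"
    by (auto simp: C_def roughly_weighted_def weight_def ball_Un sum_subset_indicator)
  finally have "closed ({1..} \<inter> {\<alpha>. roughly_weighted n \<alpha> f})"
    by (intro closed_Int closed_atLeast)
  then show ?thesis by (simp add: Int_def)
qed

lemma closed_cos_feasible: "closed {\<Delta>. \<exists>p. cos_feasible n f \<Delta> p}"
proof -
  \<comment> \<open>The budget equation is encoded as two opposite inequalities. The constraint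
    \<Delta> \<ge> 0 involves no payment and enters later by intersecting with
    \<open>{0..}\<close>.\<close>
  define C :: "((nat \<Rightarrow> real) \<times> (real \<Rightarrow> real)) set" where
    "C = {(\<lambda>i. if i \<in> {1..n} then 1 else 0, \<lambda>\<Delta>. real (f {1..n}) + \<Delta>),
          (\<lambda>i. if i \<in> {1..n} then - 1 else 0, \<lambda>\<Delta>. - (real (f {1..n}) + \<Delta>))} \<union>
         (\<lambda>S. (\<lambda>i. if i \<in> S then - 1 else 0, \<lambda>\<Delta>. - real (f S))) ` {S. S \<subseteq> {1..n}} \<union>
         (\<lambda>j. (\<lambda>i. if i \<in> {j} then - 1 else 0, \<lambda>\<Delta>. 0)) ` {1..n}"
  have C: "(\<forall>c\<in>C. (\<Sum>i\<in>{1..n}. fst c i * p i) \<le> snd c \<Delta>) \<longleftrightarrow>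
      (\<Sum>i\<in>{1..n}. p i) = real (f {1..n}) + \<Delta> \<and>
      (\<forall>S. S \<subseteq> {1..n} \<longrightarrow> (\<Sum>i\<in>S. p i) \<ge> real (f S)) \<and> (\<forall>i\<in>{1..n}. p i \<ge> 0)" for p \<Delta>
  proof -
    have "(\<Sum>i\<in>{1..n}. (if i \<in> {j} then - 1 else 0) * p i) = - p j" if "j \<in> {1..n}" for j
      using that by (subst sum_subset_indicator) auto
    then show ?thesis
      \<comment> \<open>Deleting \<open>singleton_iff\<close> preserves \<open>i \<in> {j}\<close>,
        the shape in which the sum was just evaluated.\<close>
      unfolding C_def ball_Un ball_simps fst_conv snd_conv
      by (subst (1 2) sum_subset_indicator) (auto simp: sum_subset_indicator simp del: singleton_iff)
  qed
  have "closed {\<Delta>. \<exists>p. \<forall>c\<in>C. (\<Sum>i\<in>{1..n}. fst c i * p i) \<le> snd c \<Delta>}"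
    by (rule closed_projection_linear_system)
      (auto simp: C_def intro!: continuous_intros)
  then have "closed ({0..} \<inter> {\<Delta>. \<exists>p. \<forall>c\<in>C. (\<Sum>i\<in>{1..n}. fst c i * p i) \<le> snd c \<Delta>})"
    by (intro closed_Int closed_atLeast)
  also have "\<dots> = {\<Delta>. \<exists>p. cos_feasible n f \<Delta> p}"
    unfolding C cos_feasible_def by auto
  finally show ?thesis .
qed

text \<open>Paying everyone 1 shows that the stability program is feasible, so that its minimum
  exists.\<close>

lemma cos_feasible_ones:
  assumes "f \<in> boolean_functions n" "f {1..n} = 1"
  shows "cos_feasible n f (real n - 1) (\<lambda>_. 1)"
proof -
  have "f S \<le> card S" if "S \<subseteq> {1..n}" for S
  proof (cases "S = {}")
    case True
    then show ?thesis using assms by (simp add: boolean_functions_def)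
  next
    case False
    have "f S \<in> {0, 1}"
      using assms(1) that by (auto simp: boolean_functions_def dest: PiE_mem)
    moreover have "finite S"
      using that finite_subset by blast
    then have "card S > 0"
      using False by (simp add: card_gt_0_iff)
    ultimately show ?thesis by auto
  qed
  \<comment> \<open>Applying the bound to the grand coalition gives \<open>n \<ge> 1\<close>, hence
    a nonnegative subsidy \<open>real n - 1\<close>.\<close>
  moreover from this[of "{1..n}"] have "n \<ge> 1"
    using assms by simp
  ultimately show ?thesis
    using assms(2) by (simp add: cos_feasible_def)
qed

lemma cos_feasible_imp_roughly_weighted:
  assumes "cos_feasible n f \<Delta> p" "f {1..n} = 1"
  shows "roughly_weighted n (1 + \<Delta>) f"
  unfolding roughly_weighted_def weight_def
proof (intro exI[of _ p] conjI allI impI)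
  fix S assume "S \<subseteq> {1..n}"
  with assms(1) have "real (f S) \<le> sum p S"
    by (simp add: cos_feasible_def)
  then show "f S = 1 \<Longrightarrow> sum p S \<ge> 1"
    by simp
  have "sum p S \<le> sum p {1..n}"
    using assms(1) \<open>S \<subseteq> {1..n}\<close> by (intro sum_mono2) (auto simp: cos_feasible_def)
  then show "sum p S \<le> 1 + \<Delta>"
    using assms by (simp add: cos_feasible_def)
qed

theorem lemma6:
  fixes n :: nat and f :: "nat set \<Rightarrow> nat"
  assumes "f \<in> boolean_functions n"
    and "f {1..n} = 1"
  shows "critical_threshold n f \<le> 1 + cost_of_stability n f"
proof -
  let ?D = "{\<Delta>. \<exists>p. cos_feasible n f \<Delta> p}"
  let ?A = "{\<alpha>. \<alpha> \<ge> 1 \<and> roughly_weighted n \<alpha> f}"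
  have "?D \<noteq> {}"
    using cos_feasible_ones[OF assms] by auto
  moreover have "bdd_below ?D"
    by (rule bdd_belowI[of _ 0]) (auto simp: cos_feasible_def)
  ultimately have "cost_of_stability n f \<in> ?D"
    using closed_Least(1)[OF closed_cos_feasible] by (simp add: cost_of_stability_def)
  then obtain p where p: "cos_feasible n f (cost_of_stability n f) p"
    by blast
  \<comment> \<open>Needed for the side condition \<alpha> \<ge> 1; the resulting member of
    \<open>?A\<close> also shows that \<open>?A\<close> is nonempty.\<close>
  then have "cost_of_stability n f \<ge> 0"
    by (simp add: cos_feasible_def)
  with cos_feasible_imp_roughly_weighted[OF p assms(2)] have "1 + cost_of_stability n f \<in> ?A"
    by simp
  moreover have "bdd_below ?A"
    by (rule bdd_belowI[of _ 1]) auto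
  ultimately show ?thesis
    using closed_Least(2)[OF closed_roughly_weighted[of n f] _ _, of "1 + cost_of_stability n f"]
    unfolding critical_threshold_def mem_Collect_eq by blast
qed

end
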